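(* Let $N\geq 2$ and let $u_1,u_2,\dots,u_N,s_1,s_2,\dots,s_N\in\mathbb{R}\mathbb{P}^1$ be $2N$ pairwise distinct points in the projective real line. Suppose that $A_1,A_2,\dots,A_N\in\mathrm{SL}(2,\mathbb{R})$ are hyperbolic matrices with $u(A_i)=u_i$ and $s(A_i)=s_i$, for $i=1,2,\dots,N$, and consider the constants \[ M_{i,j}=\max\left\{1+\left\lvert C(A_i,A_j)\right\rvert,\ 1+\frac{1}{\left\lvert C(A_i,A_j)\right\rvert}\right\}, \] for all pairs $i,j\in\{1,2,\dots,N\}$ with $i\neq j$. If \[ \tfrac{1}{2}\lvert \mathrm{tr}(A_k)\rvert > 4\,\max_{i\neq j}\{M_{i,j}\}\cdot \max_{i\neq j}\left\{\frac{\lvert C(A_i,A_j)\rvert +1}{\lvert C(A_i,A_j)-1\rvert}\right\}, \quad \text{for all } k=1,2,\dots,N, \] then the set $\{A_1,A_2,\dots,A_N\}$ is dominated.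
   Context: $\mathrm{SL}(2,\mathbb{R})$ is equipped with an operator norm $\lVert\cdot\rVert$. A finite set $\{A_1,\dots,A_N\}\subset\mathrm{SL}(2,\mathbb{R})$ is called dominated if there exist constants $C>0$ and $\lambda>1$ such that $\lVert A_{i_n}A_{i_{n-1}}\cdots A_{i_1}\rVert\geq C\lambda^n$ for any sequence $(i_j)\subset\{1,2,\dots,N\}$ and all $n\in\mathbb{N}$. A non-identity matrix $A\in\mathrm{SL}(2,\mathbb{R})$ is hyperbolic if $\lvert\mathrm{tr}(A)\rvert>2$. A hyperbolic matrix has two eigenvalues $\lvert\lambda_u(A)\rvert>\lvert\lambda_s(A)\rvert$, with distinct corresponding eigenvectors $u(A),s(A)\in\mathbb{R}\mathbb{P}^1$ (respectively). $\mathbb{R}\mathbb{P}^1$ is identified with $\mathbb{R}\cup\{\infty\}$ (the line spanned by $(x,y)^T$ corresponds to $x/y$), so that $\begin{pmatrix}a&b\\c&d\end{pmatrix}$ acts by $x\mapsto\frac{ax+b}{cx+d}$. For hyperbolic $A,B\in\mathrm{SL}(2,\mathbb{R})$ the cross-ratio is \[ C(A,B)=\frac{u(A)-u(B)}{u(A)-s(B)}\cdot\frac{s(A)-s(B)}{s(A)-u(B)}, \] with the standard conventions at infinity: if one of the points is $\infty$, the differences containing it are omitted. If $A,B$ have pairwise distinct fixed points $u(A),s(A),u(B),s(B)$, then $C(A,B)$ is a well-defined real number different from $0$ and $1$. *)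

theory Defs
  imports "HOL-Analysis.Analysis"
begin

definition SL2 :: "(real^2^2) set" where
  "SL2 = {A. det A = 1}"

definition hyperbolic :: "real^2^2 \<Rightarrow> bool" where
  "hyperbolic A \<longleftrightarrow> A \<in> SL2 \<and> A \<noteq> mat 1 \<and> \<bar>trace A\<bar> > 2"

definition is_norm :: "(real^2 \<Rightarrow> real) \<Rightarrow> bool" where
  "is_norm nrm \<longleftrightarrow>
     (\<forall>v. nrm v \<ge> 0) \<and> (\<forall>v. nrm v = 0 \<longleftrightarrow> v = 0) \<and>
     (\<forall>c v. nrm (c *\<^sub>R v) = \<bar>c\<bar> * nrm v) \<and>
     (\<forall>v w. nrm (v + w) \<le> nrm v + nrm w)"

(* The operator norm induced by an arbitrary norm on R^2; for nrm = norm this is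
   onorm of the map v |-> A *v v. *)
definition op_norm :: "(real^2 \<Rightarrow> real) \<Rightarrow> real^2^2 \<Rightarrow> real" where
  "op_norm nrm A = (SUP v\<in>{v. v \<noteq> 0}. nrm (A *v v) / nrm v)"

(* X n ** ... ** X 2 ** X 1; the value X 0 is not used. *)
fun mat_prod :: "(nat \<Rightarrow> real^2^2) \<Rightarrow> nat \<Rightarrow> real^2^2" where
  "mat_prod X 0 = mat 1"
| "mat_prod X (Suc n) = X (Suc n) ** mat_prod X n"

definition dominated :: "(real^2 \<Rightarrow> real) \<Rightarrow> (real^2^2) set \<Rightarrow> bool" where
  "dominated nrm S \<longleftrightarrow> finite S \<and> S \<subseteq> SL2 \<and>
     (\<exists>c>0. \<exists>l>1. \<forall>X. (\<forall>j. X j \<in> S) \<longrightarrow>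
        (\<forall>n\<ge>1. op_norm nrm (mat_prod X n) \<ge> c * l ^ n))"

(* The real projective line, identified with the reals together with infinity. *)
datatype rp1 = Aff real | Infty

(* The line spanned by a nonzero vector (x, y) corresponds to x / y. *)
definition line_of :: "real^2 \<Rightarrow> rp1" where
  "line_of v = (if v $ 2 = 0 then Infty else Aff (v $ 1 / v $ 2))"

definition eigenvector :: "real^2^2 \<Rightarrow> real \<Rightarrow> real^2 \<Rightarrow> bool" where
  "eigenvector A l v \<longleftrightarrow> v \<noteq> 0 \<and> A *v v = l *\<^sub>R v"

definition eigenvalue :: "real^2^2 \<Rightarrow> real \<Rightarrow> bool" where
  "eigenvalue A l \<longleftrightarrow> (\<exists>v. eigenvector A l v)"

(* The next four notions are meaningful for hyperbolic A only: such an A has exactly two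
   eigenvalues, of different absolute value, with one-dimensional eigenspaces. *)
definition lambda_u :: "real^2^2 \<Rightarrow> real" where
  "lambda_u A = (THE l. eigenvalue A l \<and> (\<exists>m. eigenvalue A m \<and> \<bar>l\<bar> > \<bar>m\<bar>))"

definition lambda_s :: "real^2^2 \<Rightarrow> real" where
  "lambda_s A = (THE l. eigenvalue A l \<and> (\<exists>m. eigenvalue A m \<and> \<bar>m\<bar> > \<bar>l\<bar>))"

definition u_pt :: "real^2^2 \<Rightarrow> rp1" where
  "u_pt A = (THE p. \<exists>v. eigenvector A (lambda_u A) v \<and> p = line_of v)"

definition s_pt :: "real^2^2 \<Rightarrow> rp1" where
  "s_pt A = (THE p. \<exists>v. eigenvector A (lambda_s A) v \<and> p = line_of v)"

(* Differences containing infinity are omitted from the cross-ratio, i.e. replaced by 1. *)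
fun pt_diff :: "rp1 \<Rightarrow> rp1 \<Rightarrow> real" where
  "pt_diff (Aff x) (Aff y) = x - y"
| "pt_diff _ _ = 1"

definition cross_ratio :: "real^2^2 \<Rightarrow> real^2^2 \<Rightarrow> real" where
  "cross_ratio A B =
     pt_diff (u_pt A) (u_pt B) / pt_diff (u_pt A) (s_pt B) *
     (pt_diff (s_pt A) (s_pt B) / pt_diff (s_pt A) (u_pt B))"

definition M_const :: "real^2^2 \<Rightarrow> real^2^2 \<Rightarrow> real" where
  "M_const A B = max (1 + \<bar>cross_ratio A B\<bar>) (1 + 1 / \<bar>cross_ratio A B\<bar>)"

end

theory Submission
  imports Defs
begin

text \<open>
  For vectors \<open>v\<close>, \<open>w\<close> of the plane let \<open>area v w\<close> be the determinant with columns \<open>v\<close> and \<open>w\<close>. It is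
  preserved by matrices of determinant one, and its vanishing says that \<open>v\<close> and \<open>w\<close> span the same line.
  A hyperbolic matrix \<open>A\<^sub>i\<close> has an eigenframe: eigenvectors \<open>u\<^sub>i\<close> and \<open>s\<^sub>i\<close> with \<open>area u\<^sub>i s\<^sub>i = 1\<close>, for
  eigenvalues \<open>l\<^sub>i\<close> and \<open>1 / l\<^sub>i\<close>. In the projective coordinate \<open>t\<^sub>i(p) = area u\<^sub>i p / area s\<^sub>i p\<close>, where
  \<open>u\<^sub>i\<close> sits at \<open>0\<close> and \<open>s\<^sub>i\<close> at infinity, \<open>A\<^sub>i\<close> is division by \<open>l\<^sub>i\<^sup>2\<close>.

  Cross-ratios compare the coordinates of the other eigenlines. On the one hand \<open>C(A\<^sub>i, A\<^sub>j)\<close> is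
  \<open>t\<^sub>i(u\<^sub>j) / t\<^sub>i(s\<^sub>j)\<close>, so the maximum \<open>M\<close> of the constants in the hypothesis bounds how far apart the
  two eigenlines of one \<open>A\<^sub>j\<close> lie as seen from \<open>A\<^sub>i\<close>. On the other hand, if the eigenlines of \<open>A\<^sub>j\<close> lie
  much farther from \<open>u\<^sub>i\<close> than those of \<open>A\<^sub>k\<close>, then \<open>C(A\<^sub>k, A\<^sub>j)\<close> is close to \<open>1\<close>, and the maximum \<open>R\<close>
  of the quotients \<open>(|C| + 1) / |C - 1|\<close> bounds this. Together (lemma \<open>spread_bound\<close>):
  \<open>|t\<^sub>i(u\<^sub>j)| \<le> 2 (M R)\<^sup>2 |t\<^sub>i(p)|\<close> for all \<open>j\<close> and every eigenline \<open>p\<close> of another matrix.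

  Since the eigenvectors matter only up to replacing \<open>(u\<^sub>i, s\<^sub>i)\<close> by \<open>(c u\<^sub>i, s\<^sub>i / c)\<close>, the coordinate
  \<open>t\<^sub>i\<close> can be rescaled so that the eigenlines of the other matrices all have \<open>|t\<^sub>i| \<ge> 2\<close>, one with
  equality (lemma \<open>balancing_factor\<close>). Then \<open>|t\<^sub>i(u\<^sub>j)| \<le> B\<^sup>2\<close> with \<open>B = 2 M R\<close>. The trace condition gives
  \<open>|l\<^sub>i| > 4 M R = 2 B\<close>, and this suffices for \<open>A\<^sub>i\<close> to map the cone \<open>|t\<^sub>j| \<le> 1\<close> around \<open>u\<^sub>j\<close> into
  the cone around \<open>u\<^sub>i\<close>, while the component along the expanding eigenvector grows by the factor
  \<open>|l\<^sub>i| / (2 B) > 1\<close> at least (lemma \<open>cone_step\<close>). Iterating this along a word, from the expanding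
  eigenvector of its first letter, gives exponential growth at a uniform rate, for every norm on the
  plane since all of them are equivalent.
\<close>

section \<open>The area form\<close>

definition area :: "real^2 \<Rightarrow> real^2 \<Rightarrow> real" where
  "area v w = v $ 1 * w $ 2 - v $ 2 * w $ 1"

lemma area_scaleR_left [simp]: "area (c *\<^sub>R v) w = c * area v w"
  by (simp add: area_def algebra_simps)

lemma area_scaleR_right [simp]: "area v (c *\<^sub>R w) = c * area v w"
  by (simp add: area_def algebra_simps)

lemma area_add_left: "area (v + v') w = area v w + area v' w"
  by (simp add: area_def algebra_simps)

lemma area_self [simp]: "area v v = 0"
  by (simp add: area_def)

lemma area_swap: "area w v = - area v w"
  by (simp add: area_def)

lemma abs_area_swap: "\<bar>area w v\<bar> = \<bar>area v w\<bar>"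
  by (simp add: area_swap [of w v])

lemma area_matrix: "area (A *v v) (A *v w) = det A * area v w"
  by (simp add: area_def det_2 matrix_vector_mult_def sum_2 algebra_simps)

text \<open>
  The Pluecker relation is the source of all identities between cross-ratios, such as the formula
  for \<open>C - 1\<close> as a quotient of areas.
\<close>

lemma plucker: "area a c * area b d = area a b * area c d + area a d * area b c"
  by (simp add: area_def algebra_simps)

lemma area_eq_0_both:
  assumes "area v u = 0" "area v s = 0" "area u s \<noteq> 0"
  shows "v = 0"
proof -
  have "v $ 1 * area u s = u $ 1 * area v s - s $ 1 * area v u"
       "v $ 2 * area u s = u $ 2 * area v s - s $ 2 * area v u"
    by (simp_all add: area_def algebra_simps)
  then show ?thesis
    using assms by (simp add: vec_eq_iff forall_2)
qed

lemma frame_expansion: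
  assumes "area u s = 1"
  shows "v = area v s *\<^sub>R u + area u v *\<^sub>R s"
proof -
  have "v $ i * area u s = area v s * u $ i + area u v * s $ i" for i
    using exhaust_2 [of i] by (auto simp: area_def algebra_simps)
  then show ?thesis
    using assms by (simp add: vec_eq_iff)
qed

lemma abs_area_le_norm: "\<bar>area v w\<bar> \<le> 2 * (norm v * norm w)"
proof -
  have "\<bar>v $ i * w $ j\<bar> \<le> norm v * norm w" for i j
    unfolding abs_mult by (intro mult_mono component_le_norm_cart) auto
  from this [of 1 2] this [of 2 1] show ?thesis
    unfolding area_def by linarith
qed

lemma area_eq_0_iff_line_of:
  assumes "v \<noteq> 0" "w \<noteq> 0"
  shows "area v w = 0 \<longleftrightarrow> line_of v = line_of w"
  using assms
  by (auto simp: area_def line_of_def vec_eq_iff forall_2 field_simps)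

section \<open>Eigenframes of hyperbolic matrices\<close>

text \<open>
  Normalising the area of the frame leaves one degree of freedom, the replacement of \<open>(u, s)\<close> by
  \<open>(c u, s / c)\<close>, which serves below to choose the size of the cone around \<open>u\<close>.
\<close>

definition eigenframe :: "real^2^2 \<Rightarrow> real \<Rightarrow> real^2 \<Rightarrow> real^2 \<Rightarrow> bool" where
  "eigenframe A l u s \<longleftrightarrow> det A = 1 \<and> \<bar>l\<bar> > 1 \<and> A *v u = l *\<^sub>R u \<and> A *v s = (1 / l) *\<^sub>R s \<and> area u s = 1"

lemma eigenframe_abs_inverse_less:
  assumes "eigenframe A l u s"
  shows "\<bar>1 / l\<bar> < \<bar>l\<bar>"
proof -
  have "\<bar>l\<bar> > 1"
    using assms by (simp add: eigenframe_def)
  then show ?thesis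
    using order_less_trans [of "\<bar>1 / l\<bar>" 1 "\<bar>l\<bar>"] by (simp add: abs_divide pos_divide_less_eq)
qed

text \<open>
  The condition on \<open>l\<close> is the characteristic equation \<open>l\<^sup>2 - (trace A) l + 1 = 0\<close>. It says that both
  rows of \<open>A - l\<close> are proportional, so a vector orthogonal to a nonzero row is an eigenvector.
\<close>

lemma eigenvector_exists:
  fixes A :: "real^2^2"
  assumes "det A = 1" "l * (trace A - l) = 1"
  shows "\<exists>v. eigenvector A l v"
proof -
  define a b c d where "a = A $ 1 $ 1" "b = A $ 1 $ 2" "c = A $ 2 $ 1" "d = A $ 2 $ 2"
  note abcd = this
  have char: "b * c = (l - a) * (l - d)"
    using assms by (simp add: abcd det_2 trace_def sum_2 algebra_simps)
  have eig: "eigenvector A l v \<longleftrightarrow> (v $ 1 \<noteq> 0 \<or> v $ 2 \<noteq> 0) \<and>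
      a * v $ 1 + b * v $ 2 = l * v $ 1 \<and> c * v $ 1 + d * v $ 2 = l * v $ 2" for v
    by (auto simp: eigenvector_def abcd matrix_vector_mult_def sum_2 vec_eq_iff forall_2)
  consider "b \<noteq> 0 \<or> l \<noteq> a" | "b = 0" "l = a" "l \<noteq> d \<or> c \<noteq> 0" | "b = 0" "c = 0" "l = a" "l = d"
    by blast
  then show ?thesis
  proof cases
    case 1
    then have "eigenvector A l (vector [b, l - a])"
      using char by (auto simp: eig algebra_simps)
    then show ?thesis ..
  next
    case 2
    have "eigenvector A l (vector [l - d, c])"
      unfolding eig vector_2 using 2 char by (auto simp: algebra_simps)
    then show ?thesis ..
  next
    case 3
    have "eigenvector A l (vector [1, 0])"
      unfolding eig vector_2 using 3 by simp
    then show ?thesis ..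
  qed
qed

text \<open>
  Pairing an eigenvector \<open>v\<close> with \<open>u\<close> and with \<open>s\<close>, and using that \<open>A\<close> preserves areas, forces
  \<open>m = 1 / l\<close> unless \<open>v\<close> is parallel to \<open>u\<close>, and \<open>m = l\<close> unless \<open>v\<close> is parallel to \<open>s\<close>. This uniqueness
  is what makes the definite descriptions behind \<open>u_pt\<close> and \<open>s_pt\<close> meaningful.
\<close>

lemma eigenvector_of_frame:
  assumes F: "eigenframe A l u s" and v: "eigenvector A m v"
  shows "m = l \<and> line_of v = line_of u \<or> m = 1 / l \<and> line_of v = line_of s"
proof -
  have l: "\<bar>l\<bar> > 1" "det A = 1" "A *v u = l *\<^sub>R u" "A *v s = (1 / l) *\<^sub>R s" "area u s = 1"
    using F by (auto simp: eigenframe_def)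
  have nz: "u \<noteq> 0" "s \<noteq> 0" "v \<noteq> 0" "l \<noteq> 0"
    using l v by (auto simp: area_def eigenvector_def)
  have Av: "A *v v = m *\<^sub>R v"
    using v by (simp add: eigenvector_def)
  have "m * l * area v u = area v u"
    using area_matrix [of A v u] by (auto simp: Av l mult.commute)
  moreover have "m * area v s = l * area v s"
    using area_matrix [of A v s] nz by (simp add: Av l field_simps)
  ultimately have "area v u * (m * l - 1) = 0" "area v s * (m - l) = 0"
    by (simp_all add: algebra_simps)
  then have "area v u = 0 \<or> m = 1 / l" "area v s = 0 \<or> m = l"
    using nz by (auto simp: eq_divide_eq mult.commute)
  moreover have "1 / l \<noteq> l"
    using eigenframe_abs_inverse_less [OF F] by auto
  moreover have "\<not> (area v u = 0 \<and> area v s = 0)"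
    using area_eq_0_both [of v u s] l nz by auto
  ultimately show ?thesis
    using nz by (auto simp: area_eq_0_iff_line_of)
qed

lemma eigenframe_points:
  assumes F: "eigenframe A l u s"
  shows "u_pt A = line_of u" "s_pt A = line_of s"
proof -
  note less = eigenframe_abs_inverse_less [OF F]
  have ev: "eigenvector A l u" "eigenvector A (1 / l) s"
    using F by (auto simp: eigenframe_def eigenvector_def area_def)
  have vals: "eigenvalue A m \<longleftrightarrow> m = l \<or> m = 1 / l" for m
    using ev eigenvector_of_frame [OF F] unfolding eigenvalue_def by blast
  have lu: "lambda_u A = l"
    unfolding lambda_u_def vals
    by (rule the_equality) (use less in auto)
  have ls: "lambda_s A = 1 / l"
    unfolding lambda_s_def vals
    by (rule the_equality) (use less in auto)
  have "l \<noteq> 1 / l"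
    using less by auto
  then have lines: "eigenvector A l v \<Longrightarrow> line_of v = line_of u"
      "eigenvector A (1 / l) v \<Longrightarrow> line_of v = line_of s" for v
    using eigenvector_of_frame [OF F] by metis+
  show "u_pt A = line_of u"
    unfolding u_pt_def lu by (rule the_equality) (use ev lines in metis)+
  show "s_pt A = line_of s"
    unfolding s_pt_def ls by (rule the_equality) (use ev lines in metis)+
qed

lemma hyperbolic_eigenframe:
  assumes "hyperbolic A"
  obtains l u s where "eigenframe A l u s" "trace A = l + 1 / l"
proof -
  define t where "t = trace A"
  have A: "det A = 1" "\<bar>t\<bar> > 2"
    using assms by (auto simp: hyperbolic_def SL2_def t_def)
  define r where "r = sqrt (t\<^sup>2 - 4)"
  have "2\<^sup>2 < t\<^sup>2"
    using power_strict_mono [OF A(2), of 2] by simp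
  then have r: "r\<^sup>2 = t\<^sup>2 - 4" "r > 0"
    by (auto simp: r_def)
  \<comment> \<open>The root of larger absolute value of the characteristic polynomial.\<close>
  define l where "l = (if t > 0 then (t + r) / 2 else (t - r) / 2)"
  have l: "\<bar>l\<bar> > 1" "l * (t - l) = 1"
    using A r by (auto simp: l_def field_simps power2_eq_square)
  then have l0: "l \<noteq> 0"
    by auto
  have inv: "t - l = 1 / l"
    using l l0 by (simp add: field_simps)
  obtain u where u: "eigenvector A l u"
    using eigenvector_exists A l t_def by blast
  have "(1 / l) * (t - 1 / l) = 1"
    using inv l0 by (simp add: field_simps)
  then obtain s where s: "eigenvector A (1 / l) s"
    using eigenvector_exists A t_def by blast
  have "area u s \<noteq> 0"
  proof
    assume "area u s = 0"
    then have par: "s $ i *\<^sub>R u = u $ i *\<^sub>R s" for i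
      using exhaust_2 [of i] by (auto simp: area_def vec_eq_iff forall_2 algebra_simps)
    have "(s $ i * l) *\<^sub>R u = (s $ i * (1 / l)) *\<^sub>R u" for i
    proof -
      have "(s $ i * l) *\<^sub>R u = A *v (s $ i *\<^sub>R u)"
        using u by (simp add: eigenvector_def matrix_vector_mult_scaleR)
      also have "\<dots> = (1 / l) *\<^sub>R (u $ i *\<^sub>R s)"
        using s unfolding par by (simp add: eigenvector_def matrix_vector_mult_scaleR mult.commute)
      also have "\<dots> = (s $ i * (1 / l)) *\<^sub>R u"
        by (simp flip: par)
      finally show ?thesis .
    qed
    moreover have "l \<noteq> 1 / l"
      using l0 l(1) by (metis abs_1 abs_square_eq_1 less_irrefl nonzero_eq_divide_eq power2_eq_square)
    ultimately have "s $ i = 0" for i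
      using u l0 unfolding eigenvector_def
      by (metis mult_left_cancel scaleR_cancel_right)
    then show False
      using s by (auto simp: eigenvector_def vec_eq_iff)
  qed
  then have "eigenframe A l u ((1 / area u s) *\<^sub>R s)"
    using A l u s by (simp add: eigenframe_def eigenvector_def matrix_vector_mult_scaleR)
  then show thesis
    using that inv t_def by (metis add.commute diff_add_cancel)
qed

text \<open>
  An affine difference of points is an area divided by a normalising factor for each vector. At
  infinity the convention that differences equal \<open>1\<close> keeps this true, except for a sign, which
  depends on the side on which the infinite point stands: hence \<open>- w $ 1\<close> against \<open>v $ 1\<close>.
\<close>

lemma pt_diff_line_of:
  assumes "area v w \<noteq> 0"
  shows "area v w = (if v $ 2 = 0 then v $ 1 else v $ 2) *
    (if w $ 2 = 0 then - w $ 1 else w $ 2) * pt_diff (line_of v) (line_of w)"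
  using assms by (auto simp: area_def line_of_def field_simps)

text \<open>
  Each of the four vectors occurs once in the numerator and once in the denominator, on the same
  side of the area form, so that the normalising factors of the differences cancel, signs included.
\<close>

lemma cross_ratio_eq:
  assumes F: "eigenframe A l u s" "eigenframe B m v r"
    and ne: "area u v \<noteq> 0" "area u r \<noteq> 0" "area s v \<noteq> 0" "area s r \<noteq> 0"
  shows "cross_ratio A B = (area u v * area s r) / (area u r * area s v)"
proof -
  \<comment> \<open>Normalising factors of a vector on the left and on the right of a difference.\<close>
  define n where "n = (\<lambda>v::real^2. if v $ 2 = 0 then v $ 1 else v $ 2)"
  define n' where "n' = (\<lambda>v::real^2. if v $ 2 = 0 then - v $ 1 else v $ 2)"
  have eq: "area v w = n v * n' w * pt_diff (line_of v) (line_of w)" if "area v w \<noteq> 0" for v w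
    using pt_diff_line_of [OF that] by (simp add: n_def n'_def)
  note eqs = ne [THEN eq]
  have "n u \<noteq> 0" "n s \<noteq> 0" "n' v \<noteq> 0" "n' r \<noteq> 0"
    using ne eqs by auto
  then have nz: "n u * n s * n' v * n' r \<noteq> 0"
    by simp
  have "(area u v * area s r) / (area u r * area s v) =
      ((n u * n s * n' v * n' r) * (pt_diff (line_of u) (line_of v) * pt_diff (line_of s) (line_of r))) /
      ((n u * n s * n' v * n' r) * (pt_diff (line_of u) (line_of r) * pt_diff (line_of s) (line_of v)))"
    unfolding eqs by (simp only: mult_ac)
  also have "\<dots> = cross_ratio A B"
    unfolding cross_ratio_def eigenframe_points [OF F(1)] eigenframe_points [OF F(2)]
    by (simp only: mult_divide_mult_cancel_left [OF nz] times_divide_times_eq)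
  finally show ?thesis ..
qed

section \<open>Norms on the plane\<close>

text \<open>
  A norm is Lipschitz for the Euclidean norm, hence continuous, and has a positive minimum on the
  compact unit circle.
\<close>

lemma is_norm_equivalent:
  assumes "is_norm nrm"
  obtains k K where "k > 0" "K > 0" "\<And>v. k * norm v \<le> nrm v" "\<And>v. nrm v \<le> K * norm v"
proof -
  have n: "nrm v \<ge> 0" "nrm v = 0 \<longleftrightarrow> v = 0" "nrm (c *\<^sub>R v) = \<bar>c\<bar> * nrm v"
    "nrm (v + w) \<le> nrm v + nrm w" for c v w
    using assms unfolding is_norm_def by auto
  define K where "K = nrm (axis 1 1) + nrm (axis 2 1) + 1"
  have K: "K > 0"
    unfolding K_def by (intro add_nonneg_pos add_nonneg_nonneg n(1)) simp
  have upper: "nrm v \<le> K * norm v" for v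
  proof -
    have "v = v $ 1 *\<^sub>R axis 1 1 + v $ 2 *\<^sub>R axis 2 1"
      by (simp add: vec_eq_iff forall_2 axis_def)
    then have "nrm v \<le> \<bar>v $ 1\<bar> * nrm (axis 1 1) + \<bar>v $ 2\<bar> * nrm (axis 2 1)"
      by (metis n(3) n(4))
    also have "\<dots> \<le> norm v * nrm (axis 1 1) + norm v * nrm (axis 2 1)"
      by (intro add_mono mult_right_mono component_le_norm_cart n)
    also have "\<dots> \<le> K * norm v"
      by (simp add: K_def algebra_simps)
    finally show ?thesis .
  qed
  have "\<bar>nrm v - nrm w\<bar> \<le> K * norm (v - w)" for v w
    using n(4) [of "v - w" w] n(4) [of "w - v" v] upper [of "v - w"] upper [of "w - v"]
    by (simp add: norm_minus_commute)
  then have "K-lipschitz_on (sphere 0 1) nrm"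
    using K by (intro lipschitz_onI) (auto simp: dist_norm)
  then have "continuous_on (sphere 0 1) nrm"
    by (rule lipschitz_on_continuous_on)
  then obtain x where x: "x \<in> sphere 0 1" "\<And>y. y \<in> sphere 0 1 \<Longrightarrow> nrm x \<le> nrm y"
    using continuous_attains_inf [of "sphere (0::real^2) 1" nrm] by (auto simp: )
  have "x \<noteq> 0"
    using x by auto
  then have "nrm x > 0"
    using n(1,2) [of x] by linarith
  moreover have "nrm x * norm v \<le> nrm v" for v
  proof (cases "v = 0")
    case False
    then have "nrm x \<le> nrm ((1 / norm v) *\<^sub>R v)"
      by (intro x) auto
    then show ?thesis
      using False by (simp add: n field_simps)
  qed (simp add: n)
  ultimately show thesis
    using that K upper by blast
qed

text \<open>
  The equivalence of norms has a second role here: it makes the set of quotients bounded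
  above, without which the supremum defining \<open>op_norm\<close> would be unspecified.
\<close>

lemma op_norm_lower_bound:
  assumes "k > 0" "K > 0" "\<And>v. k * norm v \<le> nrm v" "\<And>v. nrm v \<le> K * norm v" "v \<noteq> 0"
  shows "k / K * (norm (P *v v) / norm v) \<le> op_norm nrm P"
proof -
  have quot: "nrm (P *v w) / nrm w \<le> K * onorm ((*v) P) / k" if "w \<noteq> 0" for w
  proof -
    have "nrm (P *v w) \<le> K * (onorm ((*v) P) * norm w)"
      by (rule order_trans [OF assms(4)])
        (intro mult_left_mono onorm matrix_vector_mul_bounded_linear less_imp_le assms)
    also have "\<dots> \<le> K * (onorm ((*v) P) * (nrm w / k))"
      using assms by (intro mult_left_mono onorm_pos_le matrix_vector_mul_bounded_linear)
        (auto simp: field_simps)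
    finally have "nrm (P *v w) \<le> K * onorm ((*v) P) / k * nrm w"
      by simp
    moreover have "nrm w > 0"
      by (rule less_le_trans [OF _ assms(3)]) (simp add: assms(1) that)
    ultimately show ?thesis
      by (simp add: pos_divide_le_eq)
  qed
  have "nrm v > 0"
    by (rule less_le_trans [OF _ assms(3)]) (simp add: assms(1,5))
  have "k / K * (norm (P *v v) / norm v) = (k * norm (P *v v)) / (K * norm v)"
    by simp
  also have "\<dots> \<le> nrm (P *v v) / nrm v"
    by (intro frac_le assms \<open>nrm v > 0\<close> order_trans [OF _ assms(3)]) (use \<open>k > 0\<close> in auto)
  also have "\<dots> \<le> op_norm nrm P"
    unfolding op_norm_def
    by (rule cSUP_upper) (use assms quot in \<open>auto intro!: bdd_aboveI2\<close>)
  finally show ?thesis .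
qed

section \<open>Expanding cones\<close>

text \<open>
  In the frame \<open>(u, s)\<close> the vector \<open>v\<close> has the coordinates \<open>area v s\<close> along \<open>u\<close> and \<open>area u v\<close> along
  \<open>s\<close>, so these are the vectors that are closer to \<open>u\<close> than to \<open>s\<close> in the sense of the frame.
\<close>

definition eigencone :: "real^2 \<Rightarrow> real^2 \<Rightarrow> (real^2) set" where
  "eigencone u s = {v. \<bar>area u v\<bar> \<le> \<bar>area v s\<bar>}"

lemma eigenframe_coordinates:
  assumes "eigenframe A l u s"
  shows "area (A *v v) s = l * area v s" "area u (A *v v) = area u v / l"
proof -
  have F: "det A = 1" "l \<noteq> 0" "A *v u = l *\<^sub>R u" "A *v s = (1 / l) *\<^sub>R s"
    using assms by (auto simp: eigenframe_def)
  show "area (A *v v) s = l * area v s" "area u (A *v v) = area u v / l"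
    using area_matrix [of A v s] area_matrix [of A u v] F by (simp_all add: field_simps)
qed

text \<open>
  Both eigenvectors \<open>u\<close>, \<open>s\<close> of \<open>A\<close> have slope at least \<open>2\<close> in the frame \<open>(u', s')\<close>, so a vector \<open>v\<close> in
  the cone of slope \<open>1\<close> behaves like \<open>u'\<close> up to bounded factors: its slope in the frame \<open>(u, s)\<close> is at
  most \<open>3\<close> times that of \<open>u'\<close>, hence at most \<open>3 B\<^sup>2\<close>, and \<open>A\<close> divides slopes by \<open>l\<^sup>2 \<ge> 4 B\<^sup>2\<close>. Expansion
  needs a lower bound for \<open>area u' s\<close>, the component of \<open>u'\<close> along \<open>u\<close>. As the frames have area one, the
  Pluecker relation and the separation of the frames give \<open>|area u' u| |area u' s| \<ge> 1\<close>; the quotient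
  of these two areas is at most \<open>B\<^sup>2\<close>, so the second one is at least \<open>1 / B\<close>.
\<close>

lemma cone_step:
  assumes F: "eigenframe A l u s" and v: "v \<in> eigencone u' s'" and fr: "area u' s' = 1"
    and sep': "2 * \<bar>area s' u\<bar> \<le> \<bar>area u' u\<bar>" "2 * \<bar>area s' s\<bar> \<le> \<bar>area u' s\<bar>"
    and sep: "2 * \<bar>area s u'\<bar> \<le> \<bar>area u u'\<bar>"
    and B: "\<bar>area u u'\<bar> \<le> B\<^sup>2 * \<bar>area u' s\<bar>" and "B \<ge> 1" "q \<ge> 1" "2 * B * q \<le> \<bar>l\<bar>"
  shows "A *v v \<in> eigencone u s \<and> q * \<bar>area v s'\<bar> \<le> \<bar>area (A *v v) s\<bar>"
proof -
  define f g where "f = area v s'" and "g = area u' v"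
  define U X Y S where "U = area u' u" "X = area s' u" "Y = area u' s" "S = area s' s"
  note defs = this
  have gf: "\<bar>g\<bar> \<le> \<bar>f\<bar>"
    using v by (simp add: eigencone_def f_def g_def)
  have us: "area u s = 1"
    using F by (simp add: eigenframe_def)
  have "2 * \<bar>X\<bar> \<le> \<bar>U\<bar>" "2 * \<bar>S\<bar> \<le> \<bar>Y\<bar>" "2 * \<bar>Y\<bar> \<le> \<bar>U\<bar>" "\<bar>U\<bar> \<le> B\<^sup>2 * \<bar>Y\<bar>"
    using sep sep' B unfolding defs abs_area_swap [of s u'] abs_area_swap [of u u'] by auto
  note ineqs = this
  have one: "1 = U * S - Y * X"
    using plucker [of u' s' u s] us fr area_swap [of u s'] unfolding defs by simp
  have "1 \<le> \<bar>U\<bar> * \<bar>S\<bar> + \<bar>Y\<bar> * \<bar>X\<bar>"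
    using one abs_mult [of U S] abs_mult [of Y X] by linarith
  also have "\<dots> \<le> \<bar>U\<bar> * (\<bar>Y\<bar> / 2) + \<bar>Y\<bar> * (\<bar>U\<bar> / 2)"
    using ineqs by (intro add_mono mult_left_mono) auto
  also have "\<dots> = \<bar>U\<bar> * \<bar>Y\<bar>"
    by simp
  also have "\<dots> \<le> B\<^sup>2 * \<bar>Y\<bar> * \<bar>Y\<bar>"
    using ineqs by (intro mult_right_mono) auto
  finally have "1\<^sup>2 \<le> (B * \<bar>Y\<bar>)\<^sup>2"
    by (simp add: power2_eq_square mult_ac)
  then have BY: "1 \<le> B * \<bar>Y\<bar>"
    by (rule power2_le_imp_le) (use \<open>B \<ge> 1\<close> in auto)
  have vs: "area v s = f * Y + g * S"
    by (subst frame_expansion [OF fr, of v]) (simp add: area_add_left defs f_def g_def)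
  have uv: "area u v = - (f * U + g * X)"
    unfolding area_swap [of u v]
    by (subst frame_expansion [OF fr, of v]) (simp add: area_add_left defs f_def g_def)
  have "\<bar>g * S\<bar> \<le> \<bar>f\<bar> * (\<bar>Y\<bar> / 2)"
    unfolding abs_mult using gf ineqs by (intro mult_mono) auto
  then have low: "\<bar>f\<bar> * \<bar>Y\<bar> \<le> 2 * \<bar>area v s\<bar>"
    using abs_triangle_ineq4 [of "f * Y + g * S" "g * S"] by (simp add: vs abs_mult)
  have "\<bar>g * X\<bar> \<le> \<bar>f\<bar> * (\<bar>U\<bar> / 2)"
    unfolding abs_mult using gf ineqs by (intro mult_mono) auto
  then have "2 * \<bar>area u v\<bar> \<le> 3 * (\<bar>f\<bar> * \<bar>U\<bar>)"
    unfolding uv abs_minus_cancel using abs_triangle_ineq [of "f * U" "g * X"] by (simp add: abs_mult)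
  also have "\<dots> \<le> 3 * (\<bar>f\<bar> * (B\<^sup>2 * \<bar>Y\<bar>))"
    using ineqs by (intro mult_left_mono) auto
  also have "\<dots> \<le> 3 * B\<^sup>2 * (2 * \<bar>area v s\<bar>)"
    using mult_left_mono [OF low, of "3 * B\<^sup>2"] by (simp add: mult_ac)
  finally have high: "\<bar>area u v\<bar> \<le> 3 * B\<^sup>2 * \<bar>area v s\<bar>"
    by (simp add: mult_ac)
  have "2 * B * 1 \<le> 2 * B * q"
    using \<open>B \<ge> 1\<close> \<open>q \<ge> 1\<close> by (intro mult_left_mono) auto
  then have "2 * B \<le> \<bar>l\<bar>"
    using \<open>2 * B * q \<le> \<bar>l\<bar>\<close> by linarith
  then have "(2 * B)\<^sup>2 \<le> \<bar>l\<bar>\<^sup>2"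
    using \<open>B \<ge> 1\<close> by (intro power_mono) auto
  then have "4 * B\<^sup>2 \<le> \<bar>l\<bar> * \<bar>l\<bar>"
    by (simp add: power_mult_distrib power2_eq_square)
  then have "3 * B\<^sup>2 \<le> \<bar>l\<bar> * \<bar>l\<bar>"
    using zero_le_power2 [of B] by linarith
  then have "\<bar>area u v\<bar> \<le> \<bar>l\<bar> * \<bar>l\<bar> * \<bar>area v s\<bar>"
    using high by (meson abs_ge_zero mult_right_mono order_trans)
  moreover have "\<bar>l\<bar> > 0"
    using F by (auto simp: eigenframe_def)
  ultimately have "A *v v \<in> eigencone u s"
    by (simp add: eigencone_def eigenframe_coordinates [OF F] abs_mult field_simps)
  moreover have "q * \<bar>f\<bar> \<le> \<bar>l\<bar> * \<bar>area v s\<bar>"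
  proof -
    have "q * \<bar>f\<bar> * 1 \<le> q * \<bar>f\<bar> * (B * \<bar>Y\<bar>)"
      using BY \<open>q \<ge> 1\<close> by (intro mult_left_mono) auto
    also have "\<dots> \<le> q * B * (2 * \<bar>area v s\<bar>)"
      using mult_left_mono [OF low, of "q * B"] \<open>q \<ge> 1\<close> \<open>B \<ge> 1\<close> by (simp add: mult_ac)
    also have "\<dots> \<le> \<bar>l\<bar> * \<bar>area v s\<bar>"
      using mult_right_mono [OF \<open>2 * B * q \<le> \<bar>l\<bar>\<close>, of "\<bar>area v s\<bar>"] by (simp add: mult_ac)
    finally show ?thesis
      by simp
  qed
  ultimately show ?thesis
    by (simp add: f_def eigenframe_coordinates [OF F] abs_mult)
qed

lemma cone_step_same:
  assumes F: "eigenframe A l u s" and v: "v \<in> eigencone u s" and "q \<le> \<bar>l\<bar>"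
  shows "A *v v \<in> eigencone u s \<and> q * \<bar>area v s\<bar> \<le> \<bar>area (A *v v) s\<bar>"
proof -
  have l: "\<bar>l\<bar> > 1"
    using F by (simp add: eigenframe_def)
  have "\<bar>area u v\<bar> / \<bar>l\<bar> \<le> \<bar>area u v\<bar> / 1"
    using l by (intro divide_left_mono) auto
  also have "\<dots> \<le> 1 * \<bar>area v s\<bar>"
    using v by (simp add: eigencone_def)
  also have "\<dots> \<le> \<bar>l\<bar> * \<bar>area v s\<bar>"
    using l by (intro mult_right_mono) auto
  finally show ?thesis
    using \<open>q \<le> \<bar>l\<bar>\<close>
    by (simp add: eigencone_def eigenframe_coordinates [OF F] abs_mult mult_right_mono)
qed

text \<open>
  The component of a vector in the \<open>i\<close>-th cone along \<open>u i\<close> is bounded by a constant times its norm, so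
  growth of this component along a word is growth of the norm of the product.
\<close>

lemma expanding_cones_dominated:
  fixes u s :: "'i \<Rightarrow> real^2" and A :: "'i \<Rightarrow> real^2^2"
  assumes nrm: "is_norm nrm" and fin: "finite I" "I \<noteq> {}" and "q > 1"
    and F: "\<And>i. i \<in> I \<Longrightarrow> eigenframe (A i) (l i) (u i) (s i)"
    and step: "\<And>i j v. \<lbrakk>i \<in> I; j \<in> I; v \<in> eigencone (u j) (s j)\<rbrakk> \<Longrightarrow>
      A i *v v \<in> eigencone (u i) (s i) \<and> q * \<bar>area v (s j)\<bar> \<le> \<bar>area (A i *v v) (s i)\<bar>"
  shows "dominated nrm (A ` I)"
proof -
  obtain k K where kK: "k > 0" "K > 0" "\<And>v. k * norm v \<le> nrm v" "\<And>v. nrm v \<le> K * norm v"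
    using is_norm_equivalent [OF nrm] by metis
  have us: "area (u i) (s i) = 1" if "i \<in> I" for i
    using F [OF that] by (simp add: eigenframe_def)
  have nz: "u i \<noteq> 0" "s i \<noteq> 0" if "i \<in> I" for i
    using us [OF that] by (auto simp: area_def)
  define D where "D = Max ((\<lambda>(i, j). 2 * norm (u i) * norm (s j)) ` (I \<times> I))"
  have D: "2 * norm (u i) * norm (s j) \<le> D" if "i \<in> I" "j \<in> I" for i j
    unfolding D_def using that fin by (intro Max_ge) force+
  obtain i0 where "i0 \<in> I"
    using fin by auto
  have "0 < 2 * norm (u i0) * norm (s i0)"
    using nz \<open>i0 \<in> I\<close> by simp
  then have "D > 0"
    using D [OF \<open>i0 \<in> I\<close> \<open>i0 \<in> I\<close>] by linarith
  have bound: "k / (K * D) * q ^ n \<le> op_norm nrm (mat_prod X n)"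
    if X: "\<forall>j. X j \<in> A ` I" and "n \<ge> 1" for X n
  proof -
    from X have "\<forall>j. \<exists>i. i \<in> I \<and> X j = A i"
      by auto
    then obtain \<iota>' where \<iota>': "\<And>j. \<iota>' j \<in> I" "\<And>j. X j = A (\<iota>' j)"
      by metis
    \<comment> \<open>The starting vector belongs to the cone of the first letter, which is therefore repeated at index 0.\<close>
    define \<iota> where "\<iota> j = (if j = 0 then \<iota>' 1 else \<iota>' j)" for j
    have \<iota>: "\<iota> j \<in> I" "X (Suc j) = A (\<iota> (Suc j))" for j
      using \<iota>' by (auto simp: \<iota>_def)
    have "mat_prod X m *v u (\<iota> 0) \<in> eigencone (u (\<iota> m)) (s (\<iota> m)) \<and>
        q ^ m \<le> \<bar>area (mat_prod X m *v u (\<iota> 0)) (s (\<iota> m))\<bar>" for m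
    proof (induction m)
      case 0
      show ?case
        using us [OF \<iota>(1)] by (simp add: eigencone_def)
    next
      case (Suc m)
      have "q * q ^ m \<le> q * \<bar>area (mat_prod X m *v u (\<iota> 0)) (s (\<iota> m))\<bar>"
        using Suc \<open>q > 1\<close> by (intro mult_left_mono) auto
      then show ?case
        using step [OF \<iota>(1) [of "Suc m"] \<iota>(1) [of m] conjunct1 [OF Suc]]
        by (simp add: \<iota>(2) flip: matrix_vector_mul_assoc)
    qed
    then have "q ^ n \<le> \<bar>area (mat_prod X n *v u (\<iota> 0)) (s (\<iota> n))\<bar>"
      by blast
    also have "\<dots> \<le> 2 * (norm (mat_prod X n *v u (\<iota> 0)) * norm (s (\<iota> n)))"
      by (rule abs_area_le_norm)
    also have "\<dots> = (norm (mat_prod X n *v u (\<iota> 0)) / norm (u (\<iota> 0))) *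
        (2 * norm (u (\<iota> 0)) * norm (s (\<iota> n)))"
      using nz [OF \<iota>(1)] by simp
    also have "\<dots> \<le> (norm (mat_prod X n *v u (\<iota> 0)) / norm (u (\<iota> 0))) * D"
      by (intro mult_left_mono D \<iota>) auto
    finally have "q ^ n / D \<le> norm (mat_prod X n *v u (\<iota> 0)) / norm (u (\<iota> 0))"
      using \<open>D > 0\<close> by (simp add: pos_divide_le_eq)
    then have "k / K * (q ^ n / D) \<le> k / K * (norm (mat_prod X n *v u (\<iota> 0)) / norm (u (\<iota> 0)))"
      using kK(1,2) by (intro mult_left_mono) auto
    also have "\<dots> \<le> op_norm nrm (mat_prod X n)"
      by (rule op_norm_lower_bound [OF kK nz(1) [OF \<iota>(1)]])
    finally show ?thesis
      by simp
  qed
  show ?thesis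
    unfolding dominated_def
  proof (intro conjI exI)
    show "A ` I \<subseteq> SL2"
      using F by (auto simp: SL2_def eigenframe_def)
    show "k / (K * D) > 0"
      using kK \<open>D > 0\<close> by simp
  qed (use fin bound \<open>q > 1\<close> in auto)
qed

section \<open>Cross-ratios control the position of the eigenlines\<close>

text \<open>
  If \<open>q\<close>, \<open>q'\<close> were much larger than \<open>p\<close>, \<open>p'\<close>, then all four differences on the left of the last
  hypothesis would be comparable to \<open>q\<close> or \<open>q'\<close>, and the inequality would become
  \<open>|q q'| \<le> R (|p| + |p'|) (|q| + |q'|)\<close>, where the right side is at most \<open>R M |p| \<cdot> M |q'|\<close>. The
  factor \<open>R\<^sup>2\<close> in place of \<open>R\<close> matches the trace condition, which bounds the squared eigenvalues from
  below by a multiple of \<open>(M R)\<^sup>2\<close>.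
\<close>

lemma spread_bound_reals:
  fixes p p' q q' M R :: real
  assumes "M \<ge> 2" "R \<ge> 1"
    and p: "\<bar>p'\<bar> + \<bar>p\<bar> \<le> M * \<bar>p\<bar>" and q: "\<bar>q\<bar> + \<bar>q'\<bar> \<le> M * \<bar>q'\<bar>"
    and R: "\<bar>p - q\<bar> * \<bar>p' - q'\<bar> + \<bar>p - q'\<bar> * \<bar>p' - q\<bar> \<le> R * (\<bar>p - p'\<bar> * \<bar>q - q'\<bar>)"
  shows "\<bar>q\<bar> \<le> 2 * M\<^sup>2 * R\<^sup>2 * \<bar>p\<bar>"
proof (rule ccontr)
  assume "\<not> ?thesis"
  then have big: "2 * M\<^sup>2 * R\<^sup>2 * \<bar>p\<bar> < \<bar>q\<bar>"
    by simp
  have "1 * R \<le> R * R"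
    using \<open>R \<ge> 1\<close> by (intro mult_right_mono) auto
  then have "R \<le> R\<^sup>2"
    by (simp add: power2_eq_square)
  then have "2 * M\<^sup>2 * R * \<bar>p\<bar> \<le> 2 * M\<^sup>2 * R\<^sup>2 * \<bar>p\<bar>"
    by (intro mult_left_mono mult_right_mono) auto
  then have bigR: "2 * M\<^sup>2 * R * \<bar>p\<bar> < \<bar>q\<bar>"
    using big by simp
  have "2 * M\<^sup>2 * 1 * \<bar>p\<bar> \<le> 2 * M\<^sup>2 * R * \<bar>p\<bar>"
    using \<open>R \<ge> 1\<close> by (intro mult_left_mono mult_right_mono) auto
  then have big1: "2 * M\<^sup>2 * \<bar>p\<bar> < \<bar>q\<bar>"
    using bigR by simp
  have Mp: "2 * \<bar>p\<bar> \<le> M * \<bar>p\<bar>"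
    using \<open>M \<ge> 2\<close> by (intro mult_right_mono) auto
  have MMp: "2 * (M * \<bar>p\<bar>) \<le> M * (M * \<bar>p\<bar>)"
    using \<open>M \<ge> 2\<close> by (intro mult_right_mono) auto
  have "M * (2 * M * \<bar>p\<bar>) < M * \<bar>q'\<bar>"
    using big1 q by (simp add: power2_eq_square mult_ac)
  then have q'p: "2 * M * \<bar>p\<bar> < \<bar>q'\<bar>"
    using \<open>M \<ge> 2\<close> by (simp add: mult_less_cancel_left)
  \<comment> \<open>These fractions are just small enough: below, \<open>7/8 \<cdot> 1/2 + 3/4 \<cdot> 3/4 = 1\<close>.\<close>
  have "\<bar>p\<bar> \<le> \<bar>q\<bar> / 8" "\<bar>p'\<bar> \<le> \<bar>q\<bar> / 4" "\<bar>p\<bar> \<le> \<bar>q'\<bar> / 4" "\<bar>p'\<bar> \<le> \<bar>q'\<bar> / 2"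
    using Mp MMp big1 q'p p abs_ge_zero [of p] abs_ge_zero [of p']
    unfolding power2_eq_square mult.assoc by linarith+
  then have "7 / 8 * \<bar>q\<bar> \<le> \<bar>p - q\<bar>" "1 / 2 * \<bar>q'\<bar> \<le> \<bar>p' - q'\<bar>" "3 / 4 * \<bar>q'\<bar> \<le> \<bar>p - q'\<bar>" "3 / 4 * \<bar>q\<bar> \<le> \<bar>p' - q\<bar>"
    by linarith+
  then have "(7 / 8 * \<bar>q\<bar>) * (1 / 2 * \<bar>q'\<bar>) + (3 / 4 * \<bar>q'\<bar>) * (3 / 4 * \<bar>q\<bar>)
      \<le> \<bar>p - q\<bar> * \<bar>p' - q'\<bar> + \<bar>p - q'\<bar> * \<bar>p' - q\<bar>"
    by (intro add_mono mult_mono) auto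
  also have "\<dots> \<le> R * (\<bar>p - p'\<bar> * \<bar>q - q'\<bar>)"
    by (rule R)
  also have "\<dots> \<le> R * ((M * \<bar>p\<bar>) * (M * \<bar>q'\<bar>))"
    using p q \<open>R \<ge> 1\<close> \<open>M \<ge> 2\<close> by (intro mult_left_mono mult_mono) auto
  finally have "\<bar>q\<bar> * \<bar>q'\<bar> \<le> (M\<^sup>2 * R * \<bar>p\<bar>) * \<bar>q'\<bar>"
    by (simp add: power2_eq_square algebra_simps)
  moreover have "\<bar>q'\<bar> > 0"
    by (rule le_less_trans [OF _ q'p]) (use \<open>M \<ge> 2\<close> in simp)
  ultimately have "\<bar>q\<bar> \<le> M\<^sup>2 * R * \<bar>p\<bar>"
    by simp
  moreover have "0 \<le> M\<^sup>2 * R * \<bar>p\<bar>"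
    using \<open>R \<ge> 1\<close> by simp
  ultimately show False
    using bigR by simp
qed


text \<open>
  This is the previous estimate in the projective coordinate \<open>t p = area o' p / area z p\<close>, with
  denominators cleared. Differences of coordinates are areas, \<open>t p - t q\<close> being
  \<open>area o' z \<cdot> area p q / (area z p \<cdot> area z q)\<close>, and in the last hypothesis all the
  denominators agree. In the application \<open>(o', z)\<close>, \<open>(a, a')\<close> and \<open>(b, b')\<close> are the eigenlines of three
  different matrices.
\<close>

lemma spread_bound:
  assumes oz: "area o' z \<noteq> 0"
    and ne: "area z a \<noteq> 0" "area z a' \<noteq> 0" "area z b \<noteq> 0" "area z b' \<noteq> 0"
    and M: "M \<ge> 2" and R: "R \<ge> 1"
    and a: "\<bar>area o' a' * area z a\<bar> \<le> (M - 1) * \<bar>area o' a * area z a'\<bar>"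
    and b: "\<bar>area o' b * area z b'\<bar> \<le> (M - 1) * \<bar>area o' b' * area z b\<bar>"
    and ab: "\<bar>area a b * area a' b'\<bar> + \<bar>area a b' * area a' b\<bar> \<le> R * \<bar>area a a' * area b b'\<bar>"
  shows "\<bar>area o' b * area z a\<bar> \<le> 2 * (M * R)\<^sup>2 * \<bar>area o' a * area z b\<bar>"
proof -
  define t where "t p = area o' p / area z p" for p
  define e where "e = \<bar>area o' z\<bar>\<^sup>2 / (\<bar>area z a\<bar> * \<bar>area z a'\<bar> * \<bar>area z b\<bar> * \<bar>area z b'\<bar>)"
  have e: "e > 0"
    unfolding e_def using oz ne by simp
  have diff: "\<bar>t p - t q\<bar> = \<bar>area o' z\<bar> * \<bar>area p q\<bar> / (\<bar>area z p\<bar> * \<bar>area z q\<bar>)"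
    if "area z p \<noteq> 0" "area z q \<noteq> 0" for p q
  proof -
    have "t p - t q = (area o' p * area z q - area o' q * area z p) / (area z p * area z q)"
      using that by (simp add: t_def diff_frac_eq)
    also have "\<dots> = (area o' z * area p q) / (area z p * area z q)"
      using plucker [of o' p z q] by simp
    finally show ?thesis
      by (simp add: abs_mult)
  qed
  have "\<bar>t a - t b\<bar> * \<bar>t a' - t b'\<bar> = e * \<bar>area a b * area a' b'\<bar>"
       "\<bar>t a - t b'\<bar> * \<bar>t a' - t b\<bar> = e * \<bar>area a b' * area a' b\<bar>"
       "\<bar>t a - t a'\<bar> * \<bar>t b - t b'\<bar> = e * \<bar>area a a' * area b b'\<bar>"
    by (simp_all add: diff ne e_def abs_mult power2_eq_square mult_ac)
  then have "\<bar>t a - t b\<bar> * \<bar>t a' - t b'\<bar> + \<bar>t a - t b'\<bar> * \<bar>t a' - t b\<bar>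
      \<le> R * (\<bar>t a - t a'\<bar> * \<bar>t b - t b'\<bar>)"
    using mult_left_mono [OF ab, of e] e by (simp add: algebra_simps)
  moreover have "\<bar>t a'\<bar> \<le> (M - 1) * \<bar>t a\<bar>" "\<bar>t b\<bar> \<le> (M - 1) * \<bar>t b'\<bar>"
    using a b ne by (simp_all add: t_def abs_mult field_simps)
  ultimately have "\<bar>t b\<bar> \<le> 2 * M\<^sup>2 * R\<^sup>2 * \<bar>t a\<bar>"
    by (intro spread_bound_reals [OF M R, where p' = "t a'" and q' = "t b'"]) (auto simp: algebra_simps)
  then show ?thesis
    using ne by (simp add: t_def abs_mult field_simps)
qed

text \<open>
  Clearing denominators in \<open>|C| \<le> M - 1\<close>, \<open>1 / |C| \<le> M - 1\<close> and \<open>|C| + 1 \<le> R |C - 1|\<close>. By the Pluecker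
  relation \<open>C - 1\<close> has the numerator \<open>area u s \<cdot> area v r\<close>. The bounds \<open>M \<ge> 2\<close> and \<open>R \<ge> 1\<close> hold because
  one of \<open>|C|\<close>, \<open>1 / |C|\<close> is at least \<open>1\<close>, and by the triangle inequality.
\<close>

lemma cross_ratio_bounds:
  assumes F: "eigenframe A l u s" "eigenframe B m v r"
    and ne: "area u v \<noteq> 0" "area u r \<noteq> 0" "area s v \<noteq> 0" "area s r \<noteq> 0"
    and M: "M_const A B \<le> M" and R: "(\<bar>cross_ratio A B\<bar> + 1) / \<bar>cross_ratio A B - 1\<bar> \<le> R"
  shows "M \<ge> 2" "R \<ge> 1"
    "\<bar>area u v * area s r\<bar> \<le> (M - 1) * \<bar>area u r * area s v\<bar>"
    "\<bar>area u r * area s v\<bar> \<le> (M - 1) * \<bar>area u v * area s r\<bar>"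
    "\<bar>area u v * area s r\<bar> + \<bar>area u r * area s v\<bar> \<le> R * \<bar>area u s * area v r\<bar>"
proof -
  define x y where "x = area u v * area s r" and "y = area u r * area s v"
  have xy: "\<bar>x\<bar> > 0" "\<bar>y\<bar> > 0"
    using ne by (auto simp: x_def y_def)
  have C: "cross_ratio A B = x / y"
    using cross_ratio_eq [OF F ne] by (simp add: x_def y_def)
  have us: "area u s * area v r = x - y"
    using plucker [of u v s r] by (simp add: x_def y_def)
  have d: "\<bar>x - y\<bar> > 0"
    unfolding us [symmetric] using F by (simp add: eigenframe_def)
  have M: "1 + \<bar>x\<bar> / \<bar>y\<bar> \<le> M" "1 + \<bar>y\<bar> / \<bar>x\<bar> \<le> M"
    using M unfolding M_const_def C by simp_all
  then show *: "\<bar>area u v * area s r\<bar> \<le> (M - 1) * \<bar>area u r * area s v\<bar>"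
    "\<bar>area u r * area s v\<bar> \<le> (M - 1) * \<bar>area u v * area s r\<bar>"
    unfolding x_def [symmetric] y_def [symmetric] using xy by (auto simp: field_simps)
  have "1 \<le> \<bar>x\<bar> / \<bar>y\<bar> \<or> 1 \<le> \<bar>y\<bar> / \<bar>x\<bar>"
    using xy by (auto simp: le_divide_eq)
  then show "M \<ge> 2"
    using M by linarith
  have "(\<bar>x / y\<bar> + 1) / \<bar>x / y - 1\<bar> = (\<bar>x\<bar> + \<bar>y\<bar>) / \<bar>x - y\<bar>"
  proof -
    have "\<bar>x / y\<bar> + 1 = (\<bar>x\<bar> + \<bar>y\<bar>) / \<bar>y\<bar>"
      using xy by (simp add: field_simps)
    moreover have "x / y - 1 = (x - y) / y"
      using xy by (simp add: field_simps)
    ultimately show ?thesis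
      using xy by simp
  qed
  then have R: "(\<bar>x\<bar> + \<bar>y\<bar>) / \<bar>x - y\<bar> \<le> R"
    using R unfolding C by simp
  then show "\<bar>area u v * area s r\<bar> + \<bar>area u r * area s v\<bar> \<le> R * \<bar>area u s * area v r\<bar>"
    unfolding us x_def [symmetric] y_def [symmetric] using d by (simp add: divide_le_eq)
  have "1 \<le> (\<bar>x\<bar> + \<bar>y\<bar>) / \<bar>x - y\<bar>"
    using d by (simp add: le_divide_eq)
  then show "R \<ge> 1"
    using R by linarith
qed

section \<open>Balanced frames\<close>

text \<open>
  The factor \<open>c\<close> makes the smallest of the values \<open>c\<^sup>2 |area u p / area s p|\<close> over \<open>P\<close> equal to \<open>2\<close>, and the
  values on \<open>Q\<close> exceed this smallest one by the factor \<open>D\<close> at most.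
\<close>

lemma balancing_factor:
  assumes P: "finite P" "P \<noteq> {}" "\<And>p. p \<in> P \<Longrightarrow> area u p \<noteq> 0 \<and> area s p \<noteq> 0"
    and QP: "\<And>q p. \<lbrakk>q \<in> Q; p \<in> P\<rbrakk> \<Longrightarrow> \<bar>area u q * area s p\<bar> \<le> D * \<bar>area u p * area s q\<bar>"
  shows "\<exists>c>0. (\<forall>p\<in>P. 2 * \<bar>area s p\<bar> \<le> c\<^sup>2 * \<bar>area u p\<bar>) \<and> (\<forall>q\<in>Q. c\<^sup>2 * \<bar>area u q\<bar> \<le> 2 * D * \<bar>area s q\<bar>)"
proof -
  define \<tau> where "\<tau> p = \<bar>area u p\<bar> / \<bar>area s p\<bar>" for p
  obtain p where p: "p \<in> P" "\<And>p'. p' \<in> P \<Longrightarrow> \<tau> p \<le> \<tau> p'"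
    using ex_min_if_finite [of "\<tau> ` P"] P by (metis finite_imageI image_is_empty imageE image_eqI linorder_not_less)
  have pos: "\<bar>area u p'\<bar> > 0" "\<bar>area s p'\<bar> > 0" if "p' \<in> P" for p'
    using P(3) [OF that] by auto
  have \<tau>: "\<tau> p > 0"
    using pos [OF p(1)] by (simp add: \<tau>_def)
  define c where "c = sqrt (2 / \<tau> p)"
  have c: "c > 0" "c\<^sup>2 = 2 / \<tau> p"
    using \<tau> by (auto simp: c_def)
  have "2 * \<bar>area s p'\<bar> \<le> c\<^sup>2 * \<bar>area u p'\<bar>" if "p' \<in> P" for p'
    using p(2) [OF that] pos [OF that] \<tau> unfolding c by (simp add: \<tau>_def [of p'] field_simps)
  moreover have "c\<^sup>2 * \<bar>area u q\<bar> \<le> 2 * D * \<bar>area s q\<bar>" if "q \<in> Q" for q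
    using QP [OF that p(1)] pos [OF p(1)] unfolding c by (simp add: \<tau>_def abs_mult field_simps)
  ultimately show ?thesis
    using c(1) by blast
qed

lemma eigenframe_rescale:
  assumes "eigenframe A l u s" "c \<noteq> 0"
  shows "eigenframe A l (c *\<^sub>R u) ((1 / c) *\<^sub>R s)"
  using assms by (auto simp: eigenframe_def matrix_vector_mult_scaleR)

lemma scaled_le_iff:
  fixes c :: real
  assumes "c > 0"
  shows "k * \<bar>(1 / c) * x\<bar> \<le> \<bar>c * y\<bar> \<longleftrightarrow> k * \<bar>x\<bar> \<le> c\<^sup>2 * \<bar>y\<bar>"
    and "\<bar>c * y\<bar> \<le> k * \<bar>(1 / c) * x\<bar> \<longleftrightarrow> c\<^sup>2 * \<bar>y\<bar> \<le> k * \<bar>x\<bar>"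
  using assms by (simp_all add: abs_mult field_simps power2_eq_square)

text \<open>
  For \<open>i \<noteq> j\<close> the cones are treated by lemma \<open>cone_step\<close>; a repeated letter stays in its own cone and
  expands by \<open>|l i|\<close>, which is more.
\<close>

lemma balanced_dominated:
  fixes u s :: "'i \<Rightarrow> real^2" and A :: "'i \<Rightarrow> real^2^2"
  assumes nrm: "is_norm nrm" and fin: "finite I" "I \<noteq> {}"
    and F: "\<And>i. i \<in> I \<Longrightarrow> eigenframe (A i) (l i) (u i) (s i)"
    and sep: "\<And>i j. \<lbrakk>i \<in> I; j \<in> I; i \<noteq> j\<rbrakk> \<Longrightarrow>
      2 * \<bar>area (s j) (u i)\<bar> \<le> \<bar>area (u j) (u i)\<bar> \<and> 2 * \<bar>area (s j) (s i)\<bar> \<le> \<bar>area (u j) (s i)\<bar>"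
    and bd: "\<And>i j. \<lbrakk>i \<in> I; j \<in> I; i \<noteq> j\<rbrakk> \<Longrightarrow>
      \<bar>area (u i) (u j)\<bar> \<le> B\<^sup>2 * \<bar>area (s i) (u j)\<bar>"
    and B: "B \<ge> 1" and l: "\<And>i. i \<in> I \<Longrightarrow> \<bar>l i\<bar> > 2 * B"
  shows "dominated nrm (A ` I)"
proof -
  define q where "q = Min ((\<lambda>i. \<bar>l i\<bar> / (2 * B)) ` I)"
  have "q > 1"
    unfolding q_def using fin l B by (subst Min_gr_iff) auto
  have ql: "2 * B * q \<le> \<bar>l i\<bar>" if "i \<in> I" for i
  proof -
    have "q \<le> \<bar>l i\<bar> / (2 * B)"
      unfolding q_def using fin that by (intro Min_le) auto
    then show ?thesis
      using B by (simp add: field_simps)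
  qed
  have "A i *v v \<in> eigencone (u i) (s i) \<and> q * \<bar>area v (s j)\<bar> \<le> \<bar>area (A i *v v) (s i)\<bar>"
    if "i \<in> I" "j \<in> I" "v \<in> eigencone (u j) (s j)" for i j v
  proof (cases "i = j")
    case True
    have "1 * q \<le> 2 * B * q"
      using B \<open>q > 1\<close> by (intro mult_right_mono) auto
    then have "q \<le> \<bar>l i\<bar>"
      using ql [OF \<open>i \<in> I\<close>] by linarith
    then show ?thesis
      using cone_step_same [OF F [OF \<open>i \<in> I\<close>], of v q] that True by simp
  next
    case False
    then show ?thesis
      using that sep [OF that(1,2) False] sep [of j i] bd [OF that(1,2) False] F [of j] ql [of i] B \<open>q > 1\<close>
      by (intro cone_step [OF F, where B = B])
         (auto simp: eigenframe_def abs_area_swap [of "s i" "u j"])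
  qed
  then show ?thesis
    by (intro expanding_cones_dominated [OF nrm fin \<open>q > 1\<close> F]) auto
qed

text \<open>
  Rescaling the frames turns a bound on the spread of the coordinates of the other eigenlines, which does
  not depend on scales, into the balanced position with \<open>B = 2 G\<close>.
\<close>

lemma spread_dominated:
  fixes u s :: "'i \<Rightarrow> real^2" and A :: "'i \<Rightarrow> real^2^2"
  assumes nrm: "is_norm nrm" and fin: "finite I" and two: "\<And>i. i \<in> I \<Longrightarrow> I - {i} \<noteq> {}" and "I \<noteq> {}"
    and F: "\<And>i. i \<in> I \<Longrightarrow> eigenframe (A i) (l i) (u i) (s i)"
    and ne: "\<And>i j p. \<lbrakk>i \<in> I; j \<in> I; i \<noteq> j; p \<in> {u j, s j}\<rbrakk> \<Longrightarrow> area (u i) p \<noteq> 0 \<and> area (s i) p \<noteq> 0"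
    and spread: "\<And>i j k p. \<lbrakk>i \<in> I; j \<in> I; k \<in> I; i \<noteq> j; i \<noteq> k; p \<in> {u k, s k}\<rbrakk> \<Longrightarrow>
      \<bar>area (u i) (u j) * area (s i) p\<bar> \<le> 2 * G\<^sup>2 * \<bar>area (u i) p * area (s i) (u j)\<bar>"
    and G: "G \<ge> 1" and l: "\<And>i. i \<in> I \<Longrightarrow> \<bar>l i\<bar> > 4 * G"
  shows "dominated nrm (A ` I)"
proof -
  have "\<exists>c>0. (\<forall>p\<in>(\<Union>k\<in>I - {i}. {u k, s k}). 2 * \<bar>area (s i) p\<bar> \<le> c\<^sup>2 * \<bar>area (u i) p\<bar>) \<and>
      (\<forall>q\<in>u ` (I - {i}). c\<^sup>2 * \<bar>area (u i) q\<bar> \<le> 2 * (2 * G\<^sup>2) * \<bar>area (s i) q\<bar>)" if "i \<in> I" for i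
  proof (rule balancing_factor)
    show "finite (\<Union>k\<in>I - {i}. {u k, s k})" "(\<Union>k\<in>I - {i}. {u k, s k}) \<noteq> {}"
      using fin two [OF that] by auto
  next
    fix p assume "p \<in> (\<Union>k\<in>I - {i}. {u k, s k})"
    then obtain k where "k \<in> I" "i \<noteq> k" "p \<in> {u k, s k}"
      by blast
    then show "area (u i) p \<noteq> 0 \<and> area (s i) p \<noteq> 0"
      using ne that by blast
    fix q assume "q \<in> u ` (I - {i})"
    then obtain j where "j \<in> I" "i \<noteq> j" "q = u j"
      by blast
    then show "\<bar>area (u i) q * area (s i) p\<bar> \<le> 2 * G\<^sup>2 * \<bar>area (u i) p * area (s i) q\<bar>"
      using spread [OF that \<open>j \<in> I\<close> \<open>k \<in> I\<close> _ \<open>i \<noteq> k\<close> \<open>p \<in> {u k, s k}\<close>] by blast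
  qed
  then have "\<forall>i\<in>I. \<exists>c>0. (\<forall>k\<in>I - {i}. 2 * \<bar>area (s i) (u k)\<bar> \<le> c\<^sup>2 * \<bar>area (u i) (u k)\<bar> \<and>
      2 * \<bar>area (s i) (s k)\<bar> \<le> c\<^sup>2 * \<bar>area (u i) (s k)\<bar> \<and>
      c\<^sup>2 * \<bar>area (u i) (u k)\<bar> \<le> 4 * G\<^sup>2 * \<bar>area (s i) (u k)\<bar>)"
    by (simp add: ball_conj_distrib)
  then obtain c where c: "\<And>i. i \<in> I \<Longrightarrow> c i > 0"
    and c': "\<And>i k. \<lbrakk>i \<in> I; k \<in> I; i \<noteq> k\<rbrakk> \<Longrightarrow> 2 * \<bar>area (s i) (u k)\<bar> \<le> (c i)\<^sup>2 * \<bar>area (u i) (u k)\<bar> \<and>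
      2 * \<bar>area (s i) (s k)\<bar> \<le> (c i)\<^sup>2 * \<bar>area (u i) (s k)\<bar> \<and>
      (c i)\<^sup>2 * \<bar>area (u i) (u k)\<bar> \<le> 4 * G\<^sup>2 * \<bar>area (s i) (u k)\<bar>"
    by (metis DiffI singletonD)
  have scaled: "2 * \<bar>area ((1 / c i) *\<^sub>R s i) (u k)\<bar> \<le> \<bar>area (c i *\<^sub>R u i) (u k)\<bar>"
    "2 * \<bar>area ((1 / c i) *\<^sub>R s i) (s k)\<bar> \<le> \<bar>area (c i *\<^sub>R u i) (s k)\<bar>"
    "\<bar>area (c i *\<^sub>R u i) (u k)\<bar> \<le> (2 * G)\<^sup>2 * \<bar>area ((1 / c i) *\<^sub>R s i) (u k)\<bar>"
    if "i \<in> I" "k \<in> I" "i \<noteq> k" for i k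
    using c' [OF that] unfolding area_scaleR_left scaled_le_iff [OF c [OF that(1)]]
    by (auto simp: power_mult_distrib)
  have hom: "k * \<bar>area v (d *\<^sub>R p)\<bar> \<le> \<bar>area w (d *\<^sub>R p)\<bar>"
    if "k * \<bar>area v p\<bar> \<le> \<bar>area w p\<bar>" for k v w p d
    using mult_left_mono [OF that, of "\<bar>d\<bar>"] by (simp add: abs_mult mult_ac)
  have hom': "\<bar>area w (d *\<^sub>R p)\<bar> \<le> k * \<bar>area v (d *\<^sub>R p)\<bar>"
    if "\<bar>area w p\<bar> \<le> k * \<bar>area v p\<bar>" for k v w p d
    using mult_left_mono [OF that, of "\<bar>d\<bar>"] by (simp add: abs_mult mult_ac)
  show ?thesis
  proof (rule balanced_dominated [OF nrm fin \<open>I \<noteq> {}\<close>])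
    show "eigenframe (A i) (l i) (c i *\<^sub>R u i) ((1 / c i) *\<^sub>R s i)" if "i \<in> I" for i
      using eigenframe_rescale [OF F [OF that]] c [OF that] by simp
    show "2 * \<bar>area ((1 / c j) *\<^sub>R s j) (c i *\<^sub>R u i)\<bar> \<le> \<bar>area (c j *\<^sub>R u j) (c i *\<^sub>R u i)\<bar> \<and>
        2 * \<bar>area ((1 / c j) *\<^sub>R s j) ((1 / c i) *\<^sub>R s i)\<bar> \<le> \<bar>area (c j *\<^sub>R u j) ((1 / c i) *\<^sub>R s i)\<bar>"
      if "i \<in> I" "j \<in> I" "i \<noteq> j" for i j
      using that by (intro conjI hom scaled) auto
    show "\<bar>area (c i *\<^sub>R u i) (c j *\<^sub>R u j)\<bar> \<le> (2 * G)\<^sup>2 * \<bar>area ((1 / c i) *\<^sub>R s i) (c j *\<^sub>R u j)\<bar>"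
      if "i \<in> I" "j \<in> I" "i \<noteq> j" for i j
      by (intro hom' scaled that)
  qed (use G l in auto)
qed

section \<open>Domination from trace and cross-ratios\<close>

theorem theorem1p2:
  fixes N :: nat
    and u s :: "nat \<Rightarrow> rp1"
    and A :: "nat \<Rightarrow> real^2^2"
    and nrm :: "real^2 \<Rightarrow> real"
  assumes "is_norm nrm"
    and "N \<ge> 2"
    and "inj_on u {1..N}" and "inj_on s {1..N}" and "u ` {1..N} \<inter> s ` {1..N} = {}"
    and "\<And>i. i \<in> {1..N} \<Longrightarrow> hyperbolic (A i)"
    and "\<And>i. i \<in> {1..N} \<Longrightarrow> u_pt (A i) = u i"
    and "\<And>i. i \<in> {1..N} \<Longrightarrow> s_pt (A i) = s i"
    and "\<And>k. k \<in> {1..N} \<Longrightarrow>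
      1 / 2 * \<bar>trace (A k)\<bar> >
        4 * Max {M_const (A i) (A j) | i j. i \<in> {1..N} \<and> j \<in> {1..N} \<and> i \<noteq> j}
          * Max {(\<bar>cross_ratio (A i) (A j)\<bar> + 1) / \<bar>cross_ratio (A i) (A j) - 1\<bar> | i j.
                   i \<in> {1..N} \<and> j \<in> {1..N} \<and> i \<noteq> j}"
  shows "dominated nrm (A ` {1..N})"
proof -
  let ?I = "{1..N}"
  let ?MS = "{M_const (A i) (A j) | i j. i \<in> ?I \<and> j \<in> ?I \<and> i \<noteq> j}"
  let ?RS = "{(\<bar>cross_ratio (A i) (A j)\<bar> + 1) / \<bar>cross_ratio (A i) (A j) - 1\<bar> | i j. i \<in> ?I \<and> j \<in> ?I \<and> i \<noteq> j}"
  define M R where "M = Max ?MS" and "R = Max ?RS"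
  have fin: "finite {f i j | i j. i \<in> ?I \<and> j \<in> ?I \<and> i \<noteq> j}" for f :: "nat \<Rightarrow> nat \<Rightarrow> real"
  proof (rule finite_subset)
    show "{f i j | i j. i \<in> ?I \<and> j \<in> ?I \<and> i \<noteq> j} \<subseteq> {f i j | i j. i \<in> ?I \<and> j \<in> ?I}"
      by blast
    show "finite {f i j | i j. i \<in> ?I \<and> j \<in> ?I}"
      by (rule finite_image_set2) simp_all
  qed
  have MR: "M_const (A i) (A j) \<le> M"
      "(\<bar>cross_ratio (A i) (A j)\<bar> + 1) / \<bar>cross_ratio (A i) (A j) - 1\<bar> \<le> R"
    if "i \<in> ?I" "j \<in> ?I" "i \<noteq> j" for i j
    unfolding M_def R_def by (rule Max_ge [OF fin], use that in blast)+
  have "\<forall>i\<in>?I. \<exists>l v w. eigenframe (A i) l v w \<and> trace (A i) = l + 1 / l"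
    using hyperbolic_eigenframe assms(6) by metis
  then obtain l v w where F: "\<And>i. i \<in> ?I \<Longrightarrow> eigenframe (A i) (l i) (v i) (w i)"
    and tr: "\<And>i. i \<in> ?I \<Longrightarrow> trace (A i) = l i + 1 / l i"
    by metis
  have nz: "v i \<noteq> 0" "w i \<noteq> 0" if "i \<in> ?I" for i
    using F [OF that] by (auto simp: eigenframe_def area_def)
  have pts: "line_of (v i) = u i" "line_of (w i) = s i" if "i \<in> ?I" for i
    using eigenframe_points [OF F [OF that]] assms(7,8) [OF that] by simp_all
  have disj: "u i \<noteq> s j" if "i \<in> ?I" "j \<in> ?I" for i j
  proof
    assume "u i = s j"
    then have "u i \<in> s ` ?I"
      using imageI [OF that(2), of s] by (simp only:)
    then have "u i \<in> u ` ?I \<inter> s ` ?I"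
      using imageI [OF that(1), of u] by (rule IntI [rotated])
    then show False
      unfolding assms(5) by (rule emptyE)
  qed
  have ne: "area (v i) (v j) \<noteq> 0" "area (v i) (w j) \<noteq> 0" "area (w i) (v j) \<noteq> 0" "area (w i) (w j) \<noteq> 0"
    if "i \<in> ?I" "j \<in> ?I" "i \<noteq> j" for i j
  proof -
    have "u i \<noteq> u j" "s i \<noteq> s j"
      by (rule inj_on_contraD [OF assms(3) that(3,1,2)], rule inj_on_contraD [OF assms(4) that(3,1,2)])
    moreover have "u i \<noteq> s j" "s i \<noteq> u j"
      by (rule disj [OF that(1,2)], rule disj [OF that(2,1), symmetric])
    ultimately show "area (v i) (v j) \<noteq> 0" "area (v i) (w j) \<noteq> 0" "area (w i) (v j) \<noteq> 0" "area (w i) (w j) \<noteq> 0"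
      using that nz pts by (simp_all add: area_eq_0_iff_line_of)
  qed
  have cr: "M \<ge> 2" "R \<ge> 1"
    "\<bar>area (v i) (v j) * area (w i) (w j)\<bar> \<le> (M - 1) * \<bar>area (v i) (w j) * area (w i) (v j)\<bar>"
    "\<bar>area (v i) (w j) * area (w i) (v j)\<bar> \<le> (M - 1) * \<bar>area (v i) (v j) * area (w i) (w j)\<bar>"
    "\<bar>area (v i) (v j) * area (w i) (w j)\<bar> + \<bar>area (v i) (w j) * area (w i) (v j)\<bar>
      \<le> R * \<bar>area (v i) (w i) * area (v j) (w j)\<bar>"
    if "i \<in> ?I" "j \<in> ?I" "i \<noteq> j" for i j
    using cross_ratio_bounds [OF F [OF that(1)] F [OF that(2)] ne [OF that] MR [OF that]] .
  have one_two: "1 \<in> ?I" "2 \<in> ?I" "(1::nat) \<noteq> 2"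
    using assms(2) by auto
  have M: "M \<ge> 2" and R: "R \<ge> 1"
    using cr(1,2) [OF one_two] .
  have "1 * 1 \<le> M * R"
    using M R by (intro mult_mono) auto
  then have G: "M * R \<ge> 1"
    by simp
  show ?thesis
  proof (rule spread_dominated [OF assms(1), where G = "M * R"])
    show "?I - {i} \<noteq> {}" if "i \<in> ?I" for i
    proof -
      have "1 \<in> ?I - {i} \<or> 2 \<in> ?I - {i}"
        using one_two by (cases "i = 1") simp_all
      then show ?thesis
        by (elim disjE) (rule notI, simp only: empty_iff)+
    qed
    show "area (v i) p \<noteq> 0 \<and> area (w i) p \<noteq> 0"
      if "i \<in> ?I" "j \<in> ?I" "i \<noteq> j" "p \<in> {v j, w j}" for i j p
      using that(4) by (elim insertE emptyE) (simp_all only: ne [OF that(1-3)] simp_thms not_False_eq_True)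
    have half_sum: "K < \<bar>x\<bar>" if "K < 1 / 2 * \<bar>x + y\<bar>" "\<bar>y\<bar> < \<bar>x\<bar>" for K x y :: real
    proof -
      have "\<bar>x + y\<bar> < 2 * \<bar>x\<bar>"
        using abs_triangle_ineq [of x y] that(2) by simp
      then show ?thesis
        using that(1) by simp
    qed
    show "\<bar>l i\<bar> > 4 * (M * R)" if "i \<in> ?I" for i
      using assms(9) [OF that] unfolding tr [OF that] M_def [symmetric] R_def [symmetric] mult.assoc
      by (rule half_sum [OF _ eigenframe_abs_inverse_less [OF F [OF that]]])
    show "\<bar>area (v i) (v j) * area (w i) p\<bar> \<le> 2 * (M * R)\<^sup>2 * \<bar>area (v i) p * area (w i) (v j)\<bar>"
      if "i \<in> ?I" "j \<in> ?I" "k \<in> ?I" "i \<noteq> j" "i \<noteq> k" "p \<in> {v k, w k}" for i j k p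
    proof (cases "j = k")
      case True
      have "M \<le> M * R"
        using mult_left_mono [OF R, of M] M by simp
      moreover have "M * R \<le> (M * R)\<^sup>2"
        using mult_right_mono [OF G, of "M * R"] G by (simp add: power2_eq_square)
      ultimately have large: "1 \<le> 2 * (M * R)\<^sup>2" "M - 1 \<le> 2 * (M * R)\<^sup>2"
        using M G by linarith+
      from that(6) show ?thesis
      proof (elim insertE emptyE)
        assume "p = v k"
        then show ?thesis
          using mult_right_mono [OF large(1), of "\<bar>area (v i) (v j) * area (w i) (v j)\<bar>"] True by simp
      next
        assume "p = w k"
        then show ?thesis
          using order_trans [OF cr(3) [OF that(1,2,4)] mult_right_mono [OF large(2)]] True by simp
      qed
    next
      case False
      note ij = that(1,2,4) and ik = that(1,3,5) and kj = that(3,2) False [symmetric]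
      have us: "area (v i) (w i) \<noteq> 0"
        using F [OF that(1)] by (simp add: eigenframe_def)
      from that(6) show ?thesis
      proof (elim insertE emptyE)
        assume "p = v k"
        then show ?thesis
          using spread_bound [OF us _ _ _ _ M R cr(4) [OF ik] cr(3) [OF ij] cr(5) [OF kj]] ne [OF ij] ne [OF ik]
          by simp
      next
        assume "p = w k"
        moreover have "\<bar>area (w k) (v j) * area (v k) (w j)\<bar> + \<bar>area (w k) (w j) * area (v k) (v j)\<bar>
            \<le> R * \<bar>area (w k) (v k) * area (v j) (w j)\<bar>"
          using cr(5) [OF kj] by (simp add: abs_mult abs_area_swap [of "w k" "v k"] mult.commute add.commute)
        ultimately show ?thesis
          using spread_bound [OF us _ _ _ _ M R cr(3) [OF ik] cr(3) [OF ij]] ne [OF ij] ne [OF ik]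
          by simp
      qed
    qed
  qed (use F G assms(2) in auto)
qed

end
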